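(* Let $Q(x,y)\in\mathbb{R}[x,y]$ and $Rad_E(Q)=\{r\in(0,+\infty)\,:\,Q(0,\tfrac{1}{2r})=0\}$. There is a regular tubular surface in Euclidean $3$-space whose Gaussian curvature $K$ and mean curvature $H$ satisfy $Q(K,H)\equiv0$ if and only if $Rad_E(Q)\neq\emptyset$. Moreover, the radii of all such surfaces belong to $Rad_E(Q)$.
   Context: Let $\gamma:(a,b)\to\mathbb{E}^3$ be a smooth curve with nonzero tangent vectors (the central curve) and let $r>0$. The tubular surface of radius $r$ around $\gamma$ is the union of all circles of radius $r$ and center $\gamma(s)$ contained in the planes through $\gamma(s)$ normal to $\gamma'(s)$, $s\in(a,b)$; it is parametrized by the pairs $(s,v)$ with $v$ a unit vector orthogonal to $\gamma'(s)$, via $(s,v)\mapsto\gamma(s)+rv$. It is called regular if $\gamma$ is parametrized by arc length and $1-r\kappa(s)\cos t\neq0$ for all $(s,t)\in(a,b)\times\mathbb{R}$, where $\kappa=\|\gamma''\|$; the parametrization is then an immersion, and $K$ and $H$ are the Gaussian and mean curvatures of this immersed surface, where $H$ is half the sum of the principal curvatures, computed with the unit normal $-v$ at the point $(s,v)$ (pointing toward the central curve; so a cylinder of radius $r$ has $K=0$, $H=\frac1{2r}$). *)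

theory Defs
  imports "HOL-Analysis.Analysis" "HOL-Computational_Algebra.Polynomial"
begin

section \<open>Curves\<close>

definition velocity :: "(real \<Rightarrow> 'a::real_normed_vector) \<Rightarrow> real \<Rightarrow> 'a" where
  "velocity c = (\<lambda>s. vector_derivative c (at s))"

text \<open>Infinite differentiability; meant for open \<open>S\<close>, since the derivatives are two-sided.\<close>
definition smooth_curve_on :: "real set \<Rightarrow> (real \<Rightarrow> 'a::real_normed_vector) \<Rightarrow> bool" where
  "smooth_curve_on S c \<longleftrightarrow> (\<forall>n. \<forall>s\<in>S. (velocity ^^ n) c differentiable (at s))"

section \<open>Curvatures of an immersed surface\<close>

text \<open>
  An immersed surface is given by an embedded two-dimensional submanifold \<open>M\<close> of a normed space
  as parameter domain, an immersion \<open>f\<close> of \<open>M\<close> into Euclidean 3-space and a unit normal field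
  \<open>\<nu>\<close> on \<open>M\<close>. Differentials of maps on \<open>M\<close> are taken along curves in \<open>M\<close>.
\<close>

definition curve_through :: "'m::real_normed_vector set \<Rightarrow> 'm \<Rightarrow> (real \<Rightarrow> 'm) \<Rightarrow> bool" where
  "curve_through M p c \<longleftrightarrow>
     c 0 = p \<and> c differentiable (at 0) \<and> (\<forall>\<^sub>F \<tau> in nhds 0. c \<tau> \<in> M)"

definition tangent_plane ::
  "'m::real_normed_vector set \<Rightarrow> ('m \<Rightarrow> real^3) \<Rightarrow> 'm \<Rightarrow> (real^3) set" where
  "tangent_plane M f p = {velocity (f \<circ> c) 0 | c. curve_through M p c}"

text \<open>
  The shape operator is the endomorphism of the tangent plane satisfying the Weingarten relation
  \<open>A \<circ> df = - d\<nu>\<close>. Here \<open>A\<close> is a linear map of the ambient space,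
  of which only the restriction to the tangent plane matters.
\<close>
definition is_shape_operator ::
  "'m::real_normed_vector set \<Rightarrow> ('m \<Rightarrow> real^3) \<Rightarrow> ('m \<Rightarrow> real^3) \<Rightarrow> 'm \<Rightarrow>
   (real^3 \<Rightarrow> real^3) \<Rightarrow> bool" where
  "is_shape_operator M f \<nu> p A \<longleftrightarrow> linear A \<and> A ` tangent_plane M f p \<subseteq> tangent_plane M f p \<and>
     (\<forall>c. curve_through M p c \<longrightarrow> A (velocity (f \<circ> c) 0) = - velocity (\<nu> \<circ> c) 0)"

definition principal_curvatures ::
  "'m::real_normed_vector set \<Rightarrow> ('m \<Rightarrow> real^3) \<Rightarrow> ('m \<Rightarrow> real^3) \<Rightarrow> 'm \<Rightarrow>
   real \<Rightarrow> real \<Rightarrow> bool" where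
  "principal_curvatures M f \<nu> p k1 k2 \<longleftrightarrow>
     (\<exists>A u1 u2. is_shape_operator M f \<nu> p A \<and>
        norm u1 = 1 \<and> norm u2 = 1 \<and> u1 \<bullet> u2 = 0 \<and> tangent_plane M f p = span {u1, u2} \<and>
        A u1 = k1 *\<^sub>R u1 \<and> A u2 = k2 *\<^sub>R u2)"

text \<open>The principal curvatures are determined up to order, hence the symmetric functions below
  are well defined.\<close>

definition gauss_curvature ::
  "'m::real_normed_vector set \<Rightarrow> ('m \<Rightarrow> real^3) \<Rightarrow> ('m \<Rightarrow> real^3) \<Rightarrow> 'm \<Rightarrow> real" where
  "gauss_curvature M f \<nu> p = (THE K. \<exists>k1 k2. principal_curvatures M f \<nu> p k1 k2 \<and> K = k1 * k2)"

definition mean_curvature ::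
  "'m::real_normed_vector set \<Rightarrow> ('m \<Rightarrow> real^3) \<Rightarrow> ('m \<Rightarrow> real^3) \<Rightarrow> 'm \<Rightarrow> real" where
  "mean_curvature M f \<nu> p =
     (THE H. \<exists>k1 k2. principal_curvatures M f \<nu> p k1 k2 \<and> H = (k1 + k2) / 2)"

section \<open>Tubular surfaces\<close>

text \<open>\<open>einterval a b\<close> is the open interval with possibly infinite end points.\<close>
definition tubular_surface :: "ereal \<Rightarrow> ereal \<Rightarrow> (real \<Rightarrow> real^3) \<Rightarrow> real \<Rightarrow> bool" where
  "tubular_surface a b \<gamma> r \<longleftrightarrow> a < b \<and> smooth_curve_on (einterval a b) \<gamma> \<and>
     (\<forall>s\<in>einterval a b. velocity \<gamma> s \<noteq> 0) \<and> r > 0"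

definition tube_domain :: "ereal \<Rightarrow> ereal \<Rightarrow> (real \<Rightarrow> real^3) \<Rightarrow> (real \<times> (real^3)) set" where
  "tube_domain a b \<gamma> = {(s, v). s \<in> einterval a b \<and> norm v = 1 \<and> v \<bullet> velocity \<gamma> s = 0}"

definition tube_map :: "(real \<Rightarrow> real^3) \<Rightarrow> real \<Rightarrow> real \<times> (real^3) \<Rightarrow> real^3" where
  "tube_map \<gamma> r = (\<lambda>(s, v). \<gamma> s + r *\<^sub>R v)"

definition tube_normal :: "real \<times> (real^3) \<Rightarrow> real^3" where
  "tube_normal = (\<lambda>(s, v). - v)"

text \<open>Curvature of a curve parametrized by arc length.\<close>
definition curve_curvature :: "(real \<Rightarrow> real^3) \<Rightarrow> real \<Rightarrow> real" where
  "curve_curvature \<gamma> s = norm (velocity (velocity \<gamma>) s)"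

definition regular_tubular_surface ::
  "ereal \<Rightarrow> ereal \<Rightarrow> (real \<Rightarrow> real^3) \<Rightarrow> real \<Rightarrow> bool" where
  "regular_tubular_surface a b \<gamma> r \<longleftrightarrow> tubular_surface a b \<gamma> r \<and>
     (\<forall>s\<in>einterval a b. norm (velocity \<gamma> s) = 1) \<and>
     (\<forall>s\<in>einterval a b. \<forall>t::real. 1 - r * curve_curvature \<gamma> s * cos t \<noteq> 0)"

definition tube_K :: "ereal \<Rightarrow> ereal \<Rightarrow> (real \<Rightarrow> real^3) \<Rightarrow> real \<Rightarrow> real \<times> (real^3) \<Rightarrow> real" where
  "tube_K a b \<gamma> r = gauss_curvature (tube_domain a b \<gamma>) (tube_map \<gamma> r) tube_normal"

definition tube_H :: "ereal \<Rightarrow> ereal \<Rightarrow> (real \<Rightarrow> real^3) \<Rightarrow> real \<Rightarrow> real \<times> (real^3) \<Rightarrow> real" where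
  "tube_H a b \<gamma> r = mean_curvature (tube_domain a b \<gamma>) (tube_map \<gamma> r) tube_normal"

section \<open>Polynomial relations between the curvatures\<close>

text \<open>\<open>\<real>[x,y]\<close> is read as \<open>\<real>[x][y]\<close>: the coefficients of \<open>Q\<close> are polynomials in \<open>x\<close>.\<close>
definition eval_xy :: "real poly poly \<Rightarrow> real \<Rightarrow> real \<Rightarrow> real" where
  "eval_xy Q x y = poly (poly Q [:y:]) x"

definition Rad_E :: "real poly poly \<Rightarrow> real set" where
  "Rad_E Q = {r. 0 < r \<and> eval_xy Q 0 (1 / (2 * r)) = 0}"

definition curvatures_satisfy ::
  "real poly poly \<Rightarrow> ereal \<Rightarrow> ereal \<Rightarrow> (real \<Rightarrow> real^3) \<Rightarrow> real \<Rightarrow> bool" where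
  "curvatures_satisfy Q a b \<gamma> r \<longleftrightarrow>
     (\<forall>p\<in>tube_domain a b \<gamma>. eval_xy Q (tube_K a b \<gamma> r p) (tube_H a b \<gamma> r p) = 0)"

end

theory Submission
  imports Defs
begin

text \<open>
  Whenever \<open>v\<close> is orthogonal to both \<open>\<gamma>'(s)\<close> and \<open>\<gamma>''(s)\<close>, the normal of the tube is stationary
  to first order in the direction of \<open>\<gamma>'(s)\<close>, so the principal curvatures at \<open>(s, v)\<close> are \<open>0\<close> and
  \<open>1/r\<close>, as on a cylinder. Such a \<open>v\<close> exists for every \<open>s\<close>, hence any relation between \<open>K\<close> and \<open>H\<close>
  has to hold at \<open>(0, 1/(2r))\<close>. Conversely, the tube around a straight line consists of such points
  only.
\<close>

section \<open>Derivatives of curves and of normalized curves\<close>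

lemma smooth_curve_onD:
  assumes "smooth_curve_on S c" "s \<in> S"
  shows "(c has_vector_derivative velocity c s) (at s)"
    and "(velocity c has_vector_derivative velocity (velocity c) s) (at s)"
proof -
  have "(velocity ^^ 0) c differentiable (at s)" "(velocity ^^ 1) c differentiable (at s)"
    using assms unfolding smooth_curve_on_def by blast+
  then show "(c has_vector_derivative velocity c s) (at s)"
    "(velocity c has_vector_derivative velocity (velocity c) s) (at s)"
    by (simp_all add: velocity_def vector_derivative_works)
qed

lemma velocity_eq: "(c has_vector_derivative d) (at s) \<Longrightarrow> velocity c s = d"
  unfolding velocity_def by (rule vector_derivative_at)

lemma has_vector_derivative_inner:
  fixes f g :: "real \<Rightarrow> 'a::real_inner"
  assumes "(f has_vector_derivative f') (at x)" "(g has_vector_derivative g') (at x)"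
  shows "((\<lambda>t. f t \<bullet> g t) has_vector_derivative f x \<bullet> g' + f' \<bullet> g x) (at x)"
  by (rule bounded_bilinear.has_vector_derivative[OF bounded_bilinear_inner assms])

text \<open>Differentiation is local, so constraints holding only near a parameter, as in
  \<open>curve_through\<close>, still yield linear conditions on velocities.\<close>

lemma has_vector_derivative_eventually_const:
  fixes f :: "real \<Rightarrow> 'a::real_normed_vector"
  assumes "(f has_vector_derivative d) (at x)" "\<forall>\<^sub>F t in nhds x. f t = k"
  shows "d = 0"
proof -
  have "(f has_vector_derivative d) (at x) = ((\<lambda>_. k) has_vector_derivative d) (at x)"
    using assms(2) by (intro has_vector_derivative_cong_ev)
      (auto elim: eventually_mono dest: eventually_nhds_x_imp_x)
  then show ?thesis
    using assms(1) vector_derivative_at by fastforce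
qed

text \<open>As \<open>d\<close> is orthogonal to \<open>g x\<close>, the norm of \<open>g\<close> is
  stationary at \<open>x\<close>, and so is its inverse; the product rule then leaves only
  \<open>d\<close>, with factor \<open>1 / norm (g x) = 1\<close>.\<close>

lemma has_vector_derivative_sgn_orthogonal:
  fixes g :: "real \<Rightarrow> 'a::real_inner"
  assumes g: "(g has_vector_derivative d) (at x)" and "norm (g x) = 1" "d \<bullet> g x = 0"
  shows "((\<lambda>t. sgn (g t)) has_vector_derivative d) (at x)"
proof -
  have nz: "g x \<noteq> 0" using assms by auto
  have g': "(g has_derivative (\<lambda>h. h *\<^sub>R d)) (at x)"
    using g by (simp add: has_vector_derivative_def)
  have "((\<lambda>t. norm (g t)) has_derivative (\<lambda>h. (h *\<^sub>R d) \<bullet> sgn (g x))) (at x)"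
    by (rule has_derivative_compose[OF g' has_derivative_norm[OF nz]])
  then have "((\<lambda>t. norm (g t)) has_real_derivative 0) (at x)"
    using assms by (simp add: sgn_div_norm has_field_derivative_def lambda_zero)
  then have "((\<lambda>t. inverse (norm (g t))) has_real_derivative 0) (at x)"
    using nz by (auto intro!: derivative_eq_intros)
  from has_vector_derivative_scaleR[OF this g] show ?thesis
    using assms by (simp add: sgn_div_norm)
qed

section \<open>Tangent vectors of the parameter domain\<close>

text \<open>The pair (\<alpha>, y) is the velocity of \<open>c\<close> at 0. Differentiating the two
  defining equations of the domain, unit length and orthogonality to \<gamma>', gives the two
  conditions on y; the second is where \<gamma>'' enters, through the chain rule.\<close>

lemma curve_through_tube_domain_velocity:
  assumes c: "curve_through (tube_domain a b \<gamma>) (s, v) c"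
    and \<gamma>: "smooth_curve_on (einterval a b) \<gamma>"
  obtains \<alpha> y where "v \<bullet> y = 0"
    and "velocity \<gamma> s \<bullet> y = - \<alpha> * (v \<bullet> velocity (velocity \<gamma>) s)"
    and "velocity (tube_map \<gamma> r \<circ> c) 0 = \<alpha> *\<^sub>R velocity \<gamma> s + r *\<^sub>R y"
    and "velocity (tube_normal \<circ> c) 0 = - y"
proof -
  have c0: "c 0 = (s, v)" and ev: "\<forall>\<^sub>F t in nhds 0. c t \<in> tube_domain a b \<gamma>"
    and diff: "c differentiable (at 0)"
    using c by (auto simp: curve_through_def)
  obtain \<alpha> y where cd: "(c has_vector_derivative (\<alpha>, y)) (at 0)"
    using diff by (metis vector_derivative_works surj_pair)
  have s: "s \<in> einterval a b"
    using eventually_nhds_x_imp_x[OF ev] by (simp add: c0 tube_domain_def)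
  define \<sigma> w where "\<sigma> = (\<lambda>t. fst (c t))" and "w = (\<lambda>t. snd (c t))"
  have \<sigma>0: "\<sigma> 0 = s" "w 0 = v"
    by (simp_all add: \<sigma>_def w_def c0)
  have \<sigma>: "(\<sigma> has_vector_derivative \<alpha>) (at 0)"
    using bounded_linear.has_vector_derivative[OF bounded_linear_fst cd] by (simp add: \<sigma>_def)
  have w: "(w has_vector_derivative y) (at 0)"
    using bounded_linear.has_vector_derivative[OF bounded_linear_snd cd] by (simp add: w_def)
  have \<gamma>\<sigma>: "((\<lambda>t. \<gamma> (\<sigma> t)) has_vector_derivative \<alpha> *\<^sub>R velocity \<gamma> s) (at 0)"
    using vector_diff_chain_at[OF \<sigma>, of \<gamma>] smooth_curve_onD(1)[OF \<gamma> s] by (simp add: \<sigma>0 o_def)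
  have T\<sigma>: "((\<lambda>t. velocity \<gamma> (\<sigma> t)) has_vector_derivative \<alpha> *\<^sub>R velocity (velocity \<gamma>) s) (at 0)"
    using vector_diff_chain_at[OF \<sigma>, of "velocity \<gamma>"] smooth_curve_onD(2)[OF \<gamma> s]
    by (simp add: \<sigma>0 o_def)
  have "\<forall>\<^sub>F t in nhds 0. w t \<bullet> w t = 1"
    using ev by eventually_elim (auto simp: tube_domain_def w_def norm_eq_1)
  from has_vector_derivative_eventually_const[OF has_vector_derivative_inner[OF w w] this]
  have 1: "v \<bullet> y = 0"
    by (simp add: \<sigma>0 inner_commute)
  have "\<forall>\<^sub>F t in nhds 0. w t \<bullet> velocity \<gamma> (\<sigma> t) = 0"
    using ev by eventually_elim (auto simp: tube_domain_def w_def \<sigma>_def)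
  from has_vector_derivative_eventually_const[OF has_vector_derivative_inner[OF w T\<sigma>] this]
  have 2: "velocity \<gamma> s \<bullet> y = - \<alpha> * (v \<bullet> velocity (velocity \<gamma>) s)"
    by (simp add: \<sigma>0 inner_commute)
  have "((\<lambda>t. \<gamma> (\<sigma> t) + r *\<^sub>R w t) has_vector_derivative \<alpha> *\<^sub>R velocity \<gamma> s + r *\<^sub>R y) (at 0)"
    by (intro has_vector_derivative_add \<gamma>\<sigma>
        bounded_linear.has_vector_derivative[OF bounded_linear_scaleR_right w])
  moreover have "tube_map \<gamma> r \<circ> c = (\<lambda>t. \<gamma> (\<sigma> t) + r *\<^sub>R w t)"
    by (auto simp: tube_map_def \<sigma>_def w_def case_prod_unfold)
  ultimately have 3: "velocity (tube_map \<gamma> r \<circ> c) 0 = \<alpha> *\<^sub>R velocity \<gamma> s + r *\<^sub>R y"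
    by (simp add: velocity_eq)
  have "((\<lambda>t. - w t) has_vector_derivative - y) (at 0)"
    by (intro has_vector_derivative_minus w)
  moreover have "tube_normal \<circ> c = (\<lambda>t. - w t)"
    by (auto simp: tube_normal_def w_def case_prod_unfold)
  ultimately have "velocity (tube_normal \<circ> c) 0 = - y"
    by (simp add: velocity_eq)
  with 1 2 3 show thesis by (rule that)
qed

text \<open>The curve is obtained by moving \<open>v\<close> linearly with velocity \<open>y\<close>, projecting to the normal plane
  and normalizing; the orthogonality conditions on \<open>y\<close> make the last two operations harmless to
  first order.\<close>
lemma curve_through_tube_domain_exists:
  assumes \<gamma>: "smooth_curve_on (einterval a b) \<gamma>" and s: "s \<in> einterval a b"
    and unit: "\<And>t. t \<in> einterval a b \<Longrightarrow> norm (velocity \<gamma> t) = 1"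
    and v: "norm v = 1" "v \<bullet> velocity \<gamma> s = 0"
    and y: "v \<bullet> y = 0" "velocity \<gamma> s \<bullet> y = - \<alpha> * (v \<bullet> velocity (velocity \<gamma>) s)"
  obtains c where "curve_through (tube_domain a b \<gamma>) (s, v) c"
    and "velocity (tube_map \<gamma> r \<circ> c) 0 = \<alpha> *\<^sub>R velocity \<gamma> s + r *\<^sub>R y"
proof -
  define \<sigma> u T where "\<sigma> = (\<lambda>t. s + t * \<alpha>)" and "u = (\<lambda>t. v + t *\<^sub>R y)"
    and "T = (\<lambda>t. velocity \<gamma> (\<sigma> t))"
  define g where "g = (\<lambda>t. u t - (u t \<bullet> T t) *\<^sub>R T t)"
  have \<sigma>0: "\<sigma> 0 = s" "u 0 = v" "T 0 = velocity \<gamma> s"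
    by (simp_all add: \<sigma>_def u_def T_def)
  have \<sigma>: "(\<sigma> has_vector_derivative \<alpha>) (at 0)"
    unfolding \<sigma>_def by (auto intro!: derivative_eq_intros)
  have u: "(u has_vector_derivative y) (at 0)"
    unfolding u_def by (auto intro!: derivative_eq_intros)
  have \<gamma>\<sigma>: "((\<lambda>t. \<gamma> (\<sigma> t)) has_vector_derivative \<alpha> *\<^sub>R velocity \<gamma> s) (at 0)"
    using vector_diff_chain_at[OF \<sigma>, of \<gamma>] smooth_curve_onD(1)[OF \<gamma> s] by (simp add: \<sigma>0 o_def)
  have T: "(T has_vector_derivative \<alpha> *\<^sub>R velocity (velocity \<gamma>) s) (at 0)"
    using vector_diff_chain_at[OF \<sigma>, of "velocity \<gamma>"] smooth_curve_onD(2)[OF \<gamma> s]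
    by (simp add: \<sigma>0 o_def T_def)
  \<comment> \<open>The second condition on y says exactly that this derivative vanishes. Since the
    inner product is also 0 at t = 0, the correction subtracted in \<open>g\<close> vanishes to
    first order.\<close>
  have "((\<lambda>t. u t \<bullet> T t) has_vector_derivative 0) (at 0)"
    using has_vector_derivative_inner[OF u T] y by (simp add: \<sigma>0 inner_commute)
  then have "((\<lambda>t. u t \<bullet> T t) has_real_derivative 0) (at 0)"
    by (simp add: has_real_derivative_iff_has_vector_derivative)
  from has_vector_derivative_diff[OF u has_vector_derivative_scaleR[OF this T]]
  have g: "(g has_vector_derivative y) (at 0)"
    using v by (simp add: g_def \<sigma>0)
  have g0: "g 0 = v"
    using v by (simp add: g_def \<sigma>0)
  have sg: "((\<lambda>t. sgn (g t)) has_vector_derivative y) (at 0)"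
    using g0 v y by (intro has_vector_derivative_sgn_orthogonal g) (auto simp: inner_commute)
  define c where "c = (\<lambda>t. (\<sigma> t, sgn (g t)))"
  have "(c has_derivative (\<lambda>h. (h *\<^sub>R \<alpha>, h *\<^sub>R y))) (at 0)"
    using \<sigma> sg unfolding c_def has_vector_derivative_def by (intro has_derivative_Pair)
  then have diff: "c differentiable (at 0)"
    by (rule differentiableI)
  \<comment> \<open>For t near 0 the base parameter must stay in the open interval and
    \<open>g t\<close> must be nonzero, since \<open>sgn\<close> gives a unit vector only
    then.\<close>
  have "filterlim \<sigma> (nhds (\<sigma> 0)) (nhds 0)" "filterlim g (nhds (g 0)) (nhds 0)"
    using has_vector_derivative_continuous[OF \<sigma>] has_vector_derivative_continuous[OF g]
    by (simp_all add: continuous_at tendsto_at_iff_tendsto_nhds)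
  moreover have "\<sigma> 0 \<in> einterval a b" "g 0 \<in> - {0}"
    using s \<sigma>0 g0 v by auto
  ultimately have "\<forall>\<^sub>F t in nhds 0. \<sigma> t \<in> einterval a b" "\<forall>\<^sub>F t in nhds 0. g t \<in> - {0}"
    by (blast intro: topological_tendstoD open_einterval open_Compl closed_singleton)+
  then have "\<forall>\<^sub>F t in nhds 0. c t \<in> tube_domain a b \<gamma>"
  proof eventually_elim
    case (elim t)
    \<comment> \<open>Unit speed makes \<open>g t\<close> the exact orthogonal projection of
      \<open>u t\<close> to the normal plane.\<close>
    have "T t \<bullet> T t = 1"
      using unit[OF elim(1)] by (simp add: T_def norm_eq_1)
    then have "g t \<bullet> T t = 0"
      by (simp add: g_def inner_diff_left)
    then show ?case
      using elim by (auto simp: tube_domain_def c_def norm_sgn sgn_div_norm T_def)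
  qed
  moreover have "c 0 = (s, v)"
    using v by (simp add: c_def \<sigma>0 g0 sgn_div_norm)
  ultimately have "curve_through (tube_domain a b \<gamma>) (s, v) c"
    using diff by (simp add: curve_through_def)
  moreover have "((\<lambda>t. \<gamma> (\<sigma> t) + r *\<^sub>R sgn (g t)) has_vector_derivative
      \<alpha> *\<^sub>R velocity \<gamma> s + r *\<^sub>R y) (at 0)"
    by (intro has_vector_derivative_add \<gamma>\<sigma>
        bounded_linear.has_vector_derivative[OF bounded_linear_scaleR_right sg])
  moreover have "tube_map \<gamma> r \<circ> c = (\<lambda>t. \<gamma> (\<sigma> t) + r *\<^sub>R sgn (g t))"
    by (auto simp: tube_map_def c_def)
  ultimately show thesis
    using that velocity_eq by metis
qed

section \<open>The plane orthogonal to a unit vector\<close>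

lemma span_cross3_complement:
  fixes t v :: "real^3"
  assumes "norm t = 1" "norm v = 1" "t \<bullet> v = 0"
  shows "norm (cross3 t v) = 1" and "span {t, cross3 t v} = {x. x \<bullet> v = 0}"
proof -
  define b where "b = cross3 t v"
  have "(norm b)\<^sup>2 = 1"
    using norm_cross_dot[of t v] assms by (simp add: b_def)
  then show nb: "norm (cross3 t v) = 1"
    using power2_eq_imp_eq[of "norm b" 1] by (simp add: b_def)
  have orth: "t \<bullet> b = 0" "b \<bullet> t = 0" "b \<bullet> v = 0" "t \<bullet> t = 1" "b \<bullet> b = 1"
    using assms nb by (simp_all add: b_def dot_cross_self norm_eq_1)
  have "x \<in> span {t, b}" if "x \<bullet> v = 0" for x
  proof -
    define z where "z = x - (x \<bullet> t) *\<^sub>R t - (x \<bullet> b) *\<^sub>R b"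
    have z: "z \<bullet> t = 0" "z \<bullet> v = 0" "z \<bullet> b = 0"
      using orth that assms by (simp_all add: z_def inner_diff_left)
    \<comment> \<open>Triple product expansion. Both coefficients vanish, so \<open>z\<close> is
      parallel as well as orthogonal to the unit vector \<open>b\<close>; Lagrange's identity then
      forces \<open>z = 0\<close>.\<close>
    have "cross3 z b = (z \<bullet> v) *\<^sub>R t - (z \<bullet> t) *\<^sub>R v"
      by (simp add: b_def cross3_simps forall_3)
    then have "(norm z * norm b)\<^sup>2 = 0"
      using norm_cross_dot[of z b] z by simp
    then have "z = 0"
      using nb by (simp add: b_def)
    then have "x = (x \<bullet> t) *\<^sub>R t + (x \<bullet> b) *\<^sub>R b"
      by (simp add: z_def algebra_simps)
    then show ?thesis
      by (metis insertCI span_add span_base span_scale)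
  qed
  moreover have "x \<bullet> v = 0" if "x \<in> span {t, b}" for x
    using that
  proof (induction rule: span_induct)
    case base
    show ?case by (simp add: subspace_hyperplane2)
  next
    case (step x)
    then show ?case using orth assms by (auto simp: inner_commute)
  qed
  ultimately show "span {t, cross3 t v} = {x. x \<bullet> v = 0}"
    by (auto simp: b_def)
qed

lemma regular_tubular_surfaceD:
  assumes "regular_tubular_surface a b \<gamma> r"
  shows "a < b" "smooth_curve_on (einterval a b) \<gamma>" "r > 0"
    and "s \<in> einterval a b \<Longrightarrow> norm (velocity \<gamma> s) = 1"
  using assms by (auto simp: regular_tubular_surface_def tubular_surface_def)

section \<open>Principal curvatures where v is orthogonal to \<gamma>''(s)\<close>

context
  fixes a b \<gamma> r s v
  assumes reg: "regular_tubular_surface a b \<gamma> r" and p: "(s, v) \<in> tube_domain a b \<gamma>"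
    and binormal: "v \<bullet> velocity (velocity \<gamma>) s = 0"
begin

lemma unit_velocity: "norm (velocity \<gamma> s) = 1" and s_in: "s \<in> einterval a b"
  and unit_v: "norm v = 1" and v_orth: "v \<bullet> velocity \<gamma> s = 0" and r_pos: "r > 0"
  using p regular_tubular_surfaceD[OF reg] by (auto simp: tube_domain_def)

text \<open>Under \<open>binormal\<close> the second condition on y becomes orthogonality to
  \<gamma>'(s). Hence splitting x into its part along \<gamma>'(s) and the rest, divided by r, gives
  an admissible pair (\<alpha>, y).\<close>

lemma tangent_plane_binormal:
  "tangent_plane (tube_domain a b \<gamma>) (tube_map \<gamma> r) (s, v) = {x. x \<bullet> v = 0}"
proof (intro equalityI subsetI)
  fix x assume "x \<in> tangent_plane (tube_domain a b \<gamma>) (tube_map \<gamma> r) (s, v)"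
  then obtain c where c: "curve_through (tube_domain a b \<gamma>) (s, v) c"
    and x: "x = velocity (tube_map \<gamma> r \<circ> c) 0"
    unfolding tangent_plane_def by blast
  obtain \<alpha> y where "v \<bullet> y = 0" "velocity (tube_map \<gamma> r \<circ> c) 0 = \<alpha> *\<^sub>R velocity \<gamma> s + r *\<^sub>R y"
    using curve_through_tube_domain_velocity[OF c regular_tubular_surfaceD(2)[OF reg]] by metis
  then show "x \<in> {x. x \<bullet> v = 0}"
    using v_orth by (simp add: x inner_add_right inner_commute[of _ v])
next
  fix x :: "real^3" assume "x \<in> {x. x \<bullet> v = 0}"
  define \<alpha> y where "\<alpha> = x \<bullet> velocity \<gamma> s" and "y = (1 / r) *\<^sub>R (x - \<alpha> *\<^sub>R velocity \<gamma> s)"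
  have "v \<bullet> y = 0"
    using \<open>x \<in> {x. x \<bullet> v = 0}\<close> v_orth by (simp add: y_def inner_diff_right inner_commute)
  moreover have "velocity \<gamma> s \<bullet> y = - \<alpha> * (v \<bullet> velocity (velocity \<gamma>) s)"
    using unit_velocity binormal
    by (simp add: y_def \<alpha>_def inner_diff_right inner_commute norm_eq_1)
  ultimately obtain c where "curve_through (tube_domain a b \<gamma>) (s, v) c"
    "velocity (tube_map \<gamma> r \<circ> c) 0 = \<alpha> *\<^sub>R velocity \<gamma> s + r *\<^sub>R y"
    using curve_through_tube_domain_exists[OF regular_tubular_surfaceD(2)[OF reg] s_in
        regular_tubular_surfaceD(4)[OF reg] unit_v v_orth] by metis
  moreover have "x = \<alpha> *\<^sub>R velocity \<gamma> s + r *\<^sub>R y"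
    using r_pos by (simp add: y_def)
  ultimately show "x \<in> tangent_plane (tube_domain a b \<gamma>) (tube_map \<gamma> r) (s, v)"
    unfolding tangent_plane_def by (metis (mono_tags, lifting) mem_Collect_eq)
qed

text \<open>The shape operator of the round cylinder of radius r with axis direction \<gamma>'(s),
  extended to the ambient space because \<open>is_shape_operator\<close> asks for a linear map
  there.\<close>

definition cylinder_shape :: "real^3 \<Rightarrow> real^3" where
  "cylinder_shape x = (1 / r) *\<^sub>R (x - (x \<bullet> velocity \<gamma> s) *\<^sub>R velocity \<gamma> s)"

text \<open>The projection removes \<alpha> \<gamma>'(s) and keeps r y, as y is orthogonal to
  \<gamma>'(s). The factor 1/r leaves y, while the normal -v moves with velocity -y.\<close>

lemma cylinder_shape_velocity:
  assumes c: "curve_through (tube_domain a b \<gamma>) (s, v) c"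
  shows "cylinder_shape (velocity (tube_map \<gamma> r \<circ> c) 0) = - velocity (tube_normal \<circ> c) 0"
proof -
  obtain \<alpha> y where "velocity \<gamma> s \<bullet> y = - \<alpha> * (v \<bullet> velocity (velocity \<gamma>) s)"
    and eqs: "velocity (tube_map \<gamma> r \<circ> c) 0 = \<alpha> *\<^sub>R velocity \<gamma> s + r *\<^sub>R y"
      "velocity (tube_normal \<circ> c) 0 = - y"
    using curve_through_tube_domain_velocity[OF c regular_tubular_surfaceD(2)[OF reg]] by metis
  then have "y \<bullet> velocity \<gamma> s = 0"
    using binormal by (simp add: inner_commute)
  then show ?thesis
    using r_pos unit_velocity
    by (simp add: cylinder_shape_def eqs inner_add_left norm_eq_1)
qed

lemma is_shape_operator_cylinder_shape:
  "is_shape_operator (tube_domain a b \<gamma>) (tube_map \<gamma> r) tube_normal (s, v) cylinder_shape"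
proof -
  have "linear cylinder_shape"
    by (rule linearI) (simp_all add: cylinder_shape_def inner_add_left algebra_simps)
  moreover have "cylinder_shape ` {x. x \<bullet> v = 0} \<subseteq> {x. x \<bullet> v = 0}"
    using v_orth by (auto simp: cylinder_shape_def inner_diff_right inner_commute[of _ v])
  ultimately show ?thesis
    using cylinder_shape_velocity
    by (simp add: is_shape_operator_def tangent_plane_binormal)
qed

lemma principal_curvatures_binormal:
  "principal_curvatures (tube_domain a b \<gamma>) (tube_map \<gamma> r) tube_normal (s, v) 0 (1 / r)"
proof -
  \<comment> \<open>The principal directions are the axis direction \<gamma>'(s) and
    \<open>?b\<close>, the tangent at v of the circle in the normal plane.\<close>
  let ?b = "cross3 (velocity \<gamma> s) v"
  have "norm ?b = 1" "span {velocity \<gamma> s, ?b} = {x. x \<bullet> v = 0}"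
    using span_cross3_complement[of "velocity \<gamma> s" v] unit_velocity unit_v v_orth
    by (simp_all add: inner_commute)
  moreover have "velocity \<gamma> s \<bullet> ?b = 0"
    by (simp add: dot_cross_self)
  moreover from this have "cylinder_shape (velocity \<gamma> s) = 0 *\<^sub>R velocity \<gamma> s"
    "cylinder_shape ?b = (1 / r) *\<^sub>R ?b"
    using unit_velocity by (simp_all add: cylinder_shape_def norm_eq_1 inner_commute)
  ultimately show ?thesis
    unfolding principal_curvatures_def tangent_plane_binormal
    using is_shape_operator_cylinder_shape unit_velocity by blast
qed

text \<open>The image of \<open>cylinder_shape\<close> is orthogonal to \<gamma>'(s), so pairing the
  eigenvalue equation with \<gamma>'(s) leaves two cases: k = 0 or x orthogonal to the axis.\<close>

lemma cylinder_shape_eigenvector: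
  assumes "cylinder_shape x = k *\<^sub>R x" "x \<noteq> 0"
  shows "(k = 0 \<and> x = (x \<bullet> velocity \<gamma> s) *\<^sub>R velocity \<gamma> s) \<or> (k = 1 / r \<and> x \<bullet> velocity \<gamma> s = 0)"
proof -
  have "k * (x \<bullet> velocity \<gamma> s) = cylinder_shape x \<bullet> velocity \<gamma> s"
    by (simp add: assms)
  also have "\<dots> = 0"
    using unit_velocity by (simp add: cylinder_shape_def inner_diff_left norm_eq_1)
  finally consider "k = 0" | "x \<bullet> velocity \<gamma> s = 0" by auto
  then show ?thesis
  proof cases
    case 1
    then show ?thesis
      using assms r_pos by (simp add: cylinder_shape_def)
  next
    case 2
    then have "(1 / r) *\<^sub>R x = k *\<^sub>R x"
      using assms by (simp add: cylinder_shape_def)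
    then show ?thesis
      using 2 assms by (simp only: scaleR_right_imp_eq) auto
  qed
qed

text \<open>Needed to evaluate the definite descriptions of K and H. Two orthogonal unit
  eigenvectors can neither both be parallel to the axis nor both be orthogonal to it, so each
  eigenvalue occurs once.\<close>

lemma principal_curvatures_binormal_unique:
  assumes "principal_curvatures (tube_domain a b \<gamma>) (tube_map \<gamma> r) tube_normal (s, v) k1 k2"
  shows "(k1 = 0 \<and> k2 = 1 / r) \<or> (k1 = 1 / r \<and> k2 = 0)"
proof -
  let ?P = "tangent_plane (tube_domain a b \<gamma>) (tube_map \<gamma> r) (s, v)" and ?T = "velocity \<gamma> s"
  obtain A u1 u2 where A: "is_shape_operator (tube_domain a b \<gamma>) (tube_map \<gamma> r) tube_normal (s, v) A"
    and u: "norm u1 = 1" "norm u2 = 1" "u1 \<bullet> u2 = 0"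
    and P: "?P = span {u1, u2}" and eig: "A u1 = k1 *\<^sub>R u1" "A u2 = k2 *\<^sub>R u2"
    using assms unfolding principal_curvatures_def by blast
  \<comment> \<open>Every tangent vector is the velocity of some curve, so the Weingarten relation
    determines a shape operator on the whole tangent plane.\<close>
  have "A x = cylinder_shape x" if "x \<in> ?P" for x
    using that A cylinder_shape_velocity unfolding is_shape_operator_def tangent_plane_def by auto
  then have "cylinder_shape u1 = k1 *\<^sub>R u1" "cylinder_shape u2 = k2 *\<^sub>R u2"
    using eig by (metis P insertCI span_base)+
  then have 1: "(k1 = 0 \<and> u1 = (u1 \<bullet> ?T) *\<^sub>R ?T) \<or> (k1 = 1 / r \<and> u1 \<bullet> ?T = 0)"
    and 2: "(k2 = 0 \<and> u2 = (u2 \<bullet> ?T) *\<^sub>R ?T) \<or> (k2 = 1 / r \<and> u2 \<bullet> ?T = 0)"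
    using u cylinder_shape_eigenvector by fastforce+
  have False if "u1 = (u1 \<bullet> ?T) *\<^sub>R ?T" "u2 = (u2 \<bullet> ?T) *\<^sub>R ?T"
  proof -
    have "u1 \<bullet> u2 = (u1 \<bullet> ?T) * (u2 \<bullet> ?T)"
      by (subst that(2)) simp
    then have "u1 = 0 \<or> u2 = 0"
      using that u(3) by (metis mult_eq_0_iff scaleR_zero_left)
    then show False
      using u by auto
  qed
  moreover have False if "u1 \<bullet> ?T = 0" "u2 \<bullet> ?T = 0"
  proof -
    \<comment> \<open>The axis direction is itself tangent, so it would be orthogonal to the plane
      that contains it.\<close>
    have "?T \<in> span {u1, u2}"
      using v_orth P by (simp add: tangent_plane_binormal inner_commute flip: P)
    moreover have "orthogonal ?T x" if "x \<in> {u1, u2}" for x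
      using that \<open>u1 \<bullet> ?T = 0\<close> \<open>u2 \<bullet> ?T = 0\<close> by (auto simp: orthogonal_def inner_commute)
    ultimately have "orthogonal ?T ?T"
      by (rule orthogonal_to_span)
    then show False
      using unit_velocity by (auto simp: orthogonal_self)
  qed
  ultimately show ?thesis
    using 1 2 by blast
qed

lemma tube_K_binormal: "tube_K a b \<gamma> r (s, v) = 0"
  unfolding tube_K_def gauss_curvature_def
  using principal_curvatures_binormal principal_curvatures_binormal_unique
  by (intro the_equality) fastforce+

lemma tube_H_binormal: "tube_H a b \<gamma> r (s, v) = 1 / (2 * r)"
  unfolding tube_H_def mean_curvature_def
proof (rule the_equality)
  show "\<exists>k1 k2. principal_curvatures (tube_domain a b \<gamma>) (tube_map \<gamma> r) tube_normal (s, v) k1 k2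
      \<and> 1 / (2 * r) = (k1 + k2) / 2"
    using principal_curvatures_binormal by (intro exI[of _ 0] exI[of _ "1 / r"]) simp
qed (auto dest!: principal_curvatures_binormal_unique)

end

section \<open>Admissible radii and tubes around straight lines\<close>

lemma radius_in_Rad_E:
  assumes reg: "regular_tubular_surface a b \<gamma> r" and Q: "curvatures_satisfy Q a b \<gamma> r"
  shows "r \<in> Rad_E Q"
proof -
  obtain s where s: "s \<in> einterval a b"
    using einterval_nonempty regular_tubular_surfaceD(1)[OF reg] by blast
  \<comment> \<open>Two vectors cannot span 3-space, so some nonzero x is orthogonal to both. This
    replaces the Frenet binormal and also covers \<gamma>''(s) = 0.\<close>
  let ?S = "{velocity \<gamma> s, velocity (velocity \<gamma>) s}"
  have "card ?S \<le> 2"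
    by (simp add: card_insert_if)
  then have "dim ?S < DIM(real^3)"
    using dim_le_card'[of ?S] by simp
  then obtain x where x: "x \<noteq> 0" "\<And>y. y \<in> span ?S \<Longrightarrow> orthogonal x y"
    using orthogonal_to_subspace_exists by blast
  then have "x \<bullet> velocity \<gamma> s = 0" "x \<bullet> velocity (velocity \<gamma>) s = 0"
    by (simp_all add: orthogonal_def span_base)
  then have p: "(s, sgn x) \<in> tube_domain a b \<gamma>" and q: "sgn x \<bullet> velocity (velocity \<gamma>) s = 0"
    using s x by (simp_all add: tube_domain_def norm_sgn sgn_div_norm)
  show ?thesis
    using Q p tube_K_binormal[OF reg p q] tube_H_binormal[OF reg p q]
      regular_tubular_surfaceD(3)[OF reg]
    by (force simp: curvatures_satisfy_def Rad_E_def)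
qed

lemma straight_line:
  fixes e :: "'a::real_normed_vector"
  shows "velocity (\<lambda>s. s *\<^sub>R e) = (\<lambda>_. e)" "velocity (\<lambda>_. e) = (\<lambda>_. 0)"
    and "smooth_curve_on S (\<lambda>s. s *\<^sub>R e)"
proof -
  show 1: "velocity (\<lambda>s. s *\<^sub>R e) = (\<lambda>_. e)"
    by (rule ext, rule velocity_eq) (auto intro!: derivative_eq_intros)
  have const: "velocity (\<lambda>_. d) = (\<lambda>_. 0)" for d :: 'a
    by (rule ext, rule velocity_eq) simp
  then show "velocity (\<lambda>_. e) = (\<lambda>_. 0)" .
  \<comment> \<open>The iterates are constant only from the first derivative on; the line itself, n
    = 0, is treated separately.\<close>
  have "\<exists>d. (velocity ^^ Suc n) (\<lambda>s. s *\<^sub>R e) = (\<lambda>_. d)" for n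
    by (induction n) (auto simp: 1 const)
  then have "(velocity ^^ n) (\<lambda>s. s *\<^sub>R e) differentiable (at s)" for n s
    by (cases n) (auto intro!: derivative_intros, metis differentiable_const)
  then show "smooth_curve_on S (\<lambda>s. s *\<^sub>R e)"
    by (simp add: smooth_curve_on_def)
qed

text \<open>Here \<gamma>'' = 0: the regularity condition reads 1 \<noteq> 0, and every point of the
  domain satisfies \<open>binormal\<close>, so K = 0 and H = 1/(2r) throughout.\<close>

lemma straight_tube:
  assumes r: "r \<in> Rad_E Q" and e: "norm e = 1"
  shows "regular_tubular_surface a b (\<lambda>s. s *\<^sub>R e) r \<longleftrightarrow> a < b"
    and "a < b \<Longrightarrow> curvatures_satisfy Q a b (\<lambda>s. s *\<^sub>R e) r"
proof -
  have *: "r > 0" "eval_xy Q 0 (1 / (2 * r)) = 0"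
    using r by (auto simp: Rad_E_def)
  have "e \<noteq> 0"
    using e by auto
  then show reg: "regular_tubular_surface a b (\<lambda>s. s *\<^sub>R e) r \<longleftrightarrow> a < b"
    using * e by (simp add: regular_tubular_surface_def tubular_surface_def curve_curvature_def
        straight_line)
  show "curvatures_satisfy Q a b (\<lambda>s. s *\<^sub>R e) r" if "a < b"
    unfolding curvatures_satisfy_def
    using * reg that tube_K_binormal tube_H_binormal by (auto simp: straight_line)
qed

theorem corollary2:
  fixes Q :: "real poly poly"
  shows "((\<exists>a b \<gamma> r. regular_tubular_surface a b \<gamma> r \<and> curvatures_satisfy Q a b \<gamma> r) \<longleftrightarrow>
            Rad_E Q \<noteq> {}) \<and>
         (\<forall>a b \<gamma> r. regular_tubular_surface a b \<gamma> r \<and> curvatures_satisfy Q a b \<gamma> r \<longrightarrow>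
            r \<in> Rad_E Q)"
proof -
  have "\<exists>a b \<gamma> r. regular_tubular_surface a b \<gamma> r \<and> curvatures_satisfy Q a b \<gamma> r"
    if "r \<in> Rad_E Q" for r
    \<comment> \<open>The witness is the tube around a unit segment of a coordinate axis.\<close>
    using straight_tube[OF that, of "axis 1 1" 0 1] by (fastforce simp: norm_axis_1)
  then show ?thesis
    using radius_in_Rad_E by blast
qed

end
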